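(* Let $X$ be a real Hilbert space and let $f$ and $g$ be in $\Gamma_0(X)$. Then the following are equivalent: (a) $\operatorname{env}(g)\preceq_{\mathsf{M}}\operatorname{env}(f)$. (b) $\operatorname{env}(f)-\operatorname{env}(g)$ is convex. (c) $\operatorname{env}(g^* )-\operatorname{env}(f^* )$ is convex. (d) $P_g-P_f$ is monotone. (e) $\operatorname{env}(f)-\operatorname{env}(g)\in M_0(X)$. (f) $P_g-P_f\in\mathcal{P}(X)$. (g) $P_f\preceq P_g$.
   Context: $X$ is a real Hilbert space with inner product $\langle\cdot,\cdot\rangle$ and induced norm $\|\cdot\|$. $\Gamma_0(X)$ is the set of all convex, lower semicontinuous, proper functions $X\to\mathbb{R}\cup\{+\infty\}$. $f^*$ is the Fenchel conjugate of $f$. For $f\in\Gamma_0(X)$, the (Moreau) envelope is $\operatorname{env}(f)(x)=\inf_{y\in X}\big(f(y)+\tfrac12\|x-y\|^2\big)$, and $M_0(X)=\{\operatorname{env}(f): f\in\Gamma_0(X)\}$. Moreau's order on $\Gamma_0(X)$ is $g\preceq_{\mathsf{M}}f :\Leftrightarrow$ there exists $h\in\Gamma_0(X)$ with $f=g+h$. The proximal mapping of $f$ is $P_f=(\operatorname{Id}+\partial f)^{-1}\colon X\to X$, where $\partial f$ is the subdifferential, and $\mathcal{P}(X)=\{P_f : f\in\Gamma_0(X)\}$. A mapping $T\colon X\to X$ is monotone if $\langle x-y,Tx-Ty\rangle\ge0$ for all $x,y\in X$. $\mathcal{F}(X)$ is the set of firmly nonexpansive mappings, i.e. $T\colon X\to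 X$ with $\|Tx-Ty\|^2\le\langle x-y,Tx-Ty\rangle$ for all $x,y\in X$; one has $\mathcal{P}(X)\subseteq\mathcal{F}(X)$. The resolvent order on $\mathcal{F}(X)$ is $T_1\preceq T_2 :\Leftrightarrow T_2-T_1\in\mathcal{F}(X)$. *)

theory Defs
  imports "HOL-Analysis.Analysis"
begin

text \<open>
  Functions \<open>X \<rightarrow> \<real> \<union> {+\<infinity>}\<close> are modelled as functions into \<^typ>\<open>ereal\<close>; the value
  \<open>-\<infinity>\<close> is excluded by properness.
\<close>

definition epi :: "('a \<Rightarrow> ereal) \<Rightarrow> ('a \<times> real) set" where
  "epi f = {(x, r). f x \<le> ereal r}"

text \<open>
  Convexity through the epigraph is meaningful for arbitrary extended-real-valued functions, so it
  does not depend on how \<^typ>\<open>ereal\<close> resolves \<open>\<infinity> - \<infinity>\<close>. The lemmas below relate it to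
  Jensen's inequality and to \<^const>\<open>convex_on\<close>.
\<close>

definition convex_fun :: "('a::real_vector \<Rightarrow> ereal) \<Rightarrow> bool" where
  "convex_fun f \<longleftrightarrow> convex (epi f)"

lemma convex_fun_ereal_iff: "convex_fun (\<lambda>x. ereal (h x)) \<longleftrightarrow> convex_on UNIV h"
proof -
  have "epi (\<lambda>x. ereal (h x)) = epigraph UNIV h"
    by (auto simp: epi_def epigraph_def)
  then show ?thesis
    by (simp add: convex_fun_def convex_epigraph)
qed

lemma convex_fun_iff:
  assumes "\<And>x. f x \<noteq> -\<infinity>"
  shows "convex_fun f \<longleftrightarrow>
    (\<forall>x y. \<forall>t\<in>{0<..<1}. f ((1 - t) *\<^sub>R x + t *\<^sub>R y) \<le> ereal (1 - t) * f x + ereal t * f y)"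
  (is "_ \<longleftrightarrow> ?J")
proof
  assume c: "convex_fun f"
  show ?J
  proof (intro allI ballI)
    fix x y and t :: real assume t: "t \<in> {0<..<1}"
    show "f ((1 - t) *\<^sub>R x + t *\<^sub>R y) \<le> ereal (1 - t) * f x + ereal t * f y"
    proof (cases "f x = \<infinity> \<or> f y = \<infinity>")
      case True
      then have "ereal (1 - t) * f x + ereal t * f y = \<infinity>"
        using t assms[of x] assms[of y] by (cases "f x"; cases "f y") auto
      then show ?thesis by (metis ereal_less_eq(1))
    next
      case False
      then obtain a b where ab: "f x = ereal a" "f y = ereal b"
        using assms[of x] assms[of y] by (cases "f x"; cases "f y") auto
      then have "(x, a) \<in> epi f" "(y, b) \<in> epi f" by (auto simp: epi_def)
      then have "(1 - t) *\<^sub>R (x, a) + t *\<^sub>R (y, b) \<in> epi f"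
        using c t unfolding convex_fun_def convex_alt by (meson greaterThanLessThan_iff less_imp_le)
      then show ?thesis by (simp add: epi_def ab)
    qed
  qed
next
  assume J: ?J
  show "convex_fun f"
    unfolding convex_fun_def convex_alt
  proof (intro ballI allI impI)
    fix p q and t :: real
    assume p: "p \<in> epi f" and q: "q \<in> epi f" and t: "0 \<le> t \<and> t \<le> 1"
    obtain x a y b where pq: "p = (x, a)" "q = (y, b)" by (cases p; cases q)
    show "(1 - t) *\<^sub>R p + t *\<^sub>R q \<in> epi f"
    proof (cases "t = 0 \<or> t = 1")
      case True then show ?thesis using p q by auto
    next
      case False
      then have t': "t \<in> {0<..<1}" using t by auto
      have "f ((1 - t) *\<^sub>R x + t *\<^sub>R y) \<le> ereal (1 - t) * f x + ereal t * f y"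
        using J t' by blast
      also have "\<dots> \<le> ereal (1 - t) * ereal a + ereal t * ereal b"
        using p q t by (intro add_mono ereal_mult_left_mono) (auto simp: epi_def pq)
      finally show ?thesis by (simp add: epi_def pq)
    qed
  qed
qed

definition lower_semicontinuous :: "('a::topological_space \<Rightarrow> ereal) \<Rightarrow> bool" where
  "lower_semicontinuous f \<longleftrightarrow> (\<forall>x. f x \<le> Liminf (at x) f)"

definition proper_fun :: "('a \<Rightarrow> ereal) \<Rightarrow> bool" where
  "proper_fun f \<longleftrightarrow> (\<forall>x. f x \<noteq> -\<infinity>) \<and> (\<exists>x. f x \<noteq> \<infinity>)"

definition Gamma0 :: "('a::real_normed_vector \<Rightarrow> ereal) set" where
  "Gamma0 = {f. convex_fun f \<and> lower_semicontinuous f \<and> proper_fun f}"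

definition fenchel_conjugate :: "('a::real_inner \<Rightarrow> ereal) \<Rightarrow> 'a \<Rightarrow> ereal" where
  "fenchel_conjugate f u = (SUP x. ereal (x \<bullet> u) - f x)"

definition env :: "('a::real_normed_vector \<Rightarrow> ereal) \<Rightarrow> 'a \<Rightarrow> ereal" where
  "env f x = (INF y. f y + ereal ((1/2) * (norm (x - y))\<^sup>2))"

definition M0 :: "('a::real_normed_vector \<Rightarrow> ereal) set" where
  "M0 = env ` Gamma0"

definition moreau_le :: "('a::real_normed_vector \<Rightarrow> ereal) \<Rightarrow> ('a \<Rightarrow> ereal) \<Rightarrow> bool"
    (infix \<open>\<preceq>\<^sub>M\<close> 50) where
  "g \<preceq>\<^sub>M f \<longleftrightarrow> (\<exists>h\<in>Gamma0. f = (\<lambda>x. g x + h x))"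

text \<open>For proper \<open>f\<close>, the set below is empty wherever \<open>f x = \<infinity>\<close>.\<close>

definition subdifferential :: "('a::real_inner \<Rightarrow> ereal) \<Rightarrow> 'a \<Rightarrow> 'a set" where
  "subdifferential f x = {u. \<forall>y. f x + ereal ((y - x) \<bullet> u) \<le> f y}"

text \<open>
  The value at \<open>x\<close> of the inverse of the set-valued operator \<open>Id + \<partial>f\<close>. For \<open>f\<close> in
  \<^const>\<open>Gamma0\<close> on a Hilbert space this inverse is single-valued and everywhere defined, so the
  description operator picks its unique element.
\<close>

definition prox :: "('a::real_inner \<Rightarrow> ereal) \<Rightarrow> 'a \<Rightarrow> 'a" where
  "prox f x = (THE p. x \<in> {p + u |u. u \<in> subdifferential f p})"

definition prox_maps :: "('a::real_inner \<Rightarrow> 'a) set" where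
  "prox_maps = prox ` Gamma0"

definition monotone_operator :: "('a::real_inner \<Rightarrow> 'a) \<Rightarrow> bool" where
  "monotone_operator T \<longleftrightarrow> (\<forall>x y. (x - y) \<bullet> (T x - T y) \<ge> 0)"

definition firmly_nonexpansive_maps :: "('a::real_inner \<Rightarrow> 'a) set" where
  "firmly_nonexpansive_maps = {T. \<forall>x y. (norm (T x - T y))\<^sup>2 \<le> (x - y) \<bullet> (T x - T y)}"

definition resolvent_le :: "('a::real_inner \<Rightarrow> 'a) \<Rightarrow> ('a \<Rightarrow> 'a) \<Rightarrow> bool"
    (infix \<open>\<preceq>\<^sub>R\<close> 50) where
  "T1 \<preceq>\<^sub>R T2 \<longleftrightarrow> (\<lambda>x. T2 x - T1 x) \<in> firmly_nonexpansive_maps"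

end

theory Submission
  imports Defs
begin

text \<open>
  Everything is reduced to one property of a pair \<open>(h, G)\<close>, called \<open>envelope_gradient\<close> below:
  at every point \<open>x\<close>, the function \<open>h\<close> lies above the affine function with value \<open>h x\<close> and slope
  \<open>G x\<close>, and below that affine function plus \<open>\<parallel>\<cdot> - x\<parallel>\<^sup>2/2\<close>. This property describes Moreau
  envelopes completely: every \<open>f \<in> \<Gamma>\<^sub>0\<close> gives such a pair \<open>(env f, Id - P\<^sub>f)\<close>
  (\<open>Gamma0_envelope\<close>), and every such pair is \<open>(env k, Id - P\<^sub>k)\<close> for some \<open>k \<in> \<Gamma>\<^sub>0\<close>
  (\<open>envelope_gradient_imp_env\<close>). It is also stable under
  \<open>(h, G) \<mapsto> (\<parallel>\<cdot>\<parallel>\<^sup>2/2 - h, Id - G)\<close>, which on envelopes is the passage to the conjugate.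

  Put \<open>h = env f - env g\<close> and \<open>G = P\<^sub>g - P\<^sub>f\<close>. Subtracting the inequalities for \<open>g\<close> from those
  for \<open>f\<close> shows that \<open>h\<close> differs from its linearization with slope \<open>G x\<close> at \<open>x\<close> by at most
  \<open>\<parallel>\<cdot> - x\<parallel>\<^sup>2/2\<close> in absolute value. The upper half of \<open>envelope_gradient\<close> therefore
  always holds, and the lower half says that \<open>G x\<close> is a subgradient of \<open>h\<close> at every
  \<open>x\<close>. As \<open>G\<close> is the gradient of \<open>h\<close>, this is equivalent to convexity of \<open>h\<close> and to monotonicity
  of \<open>G\<close>. Once it holds, \<open>h\<close> is an envelope; and since the reflected pair is an envelope pair
  too, \<open>G = Id - (Id - G)\<close> is a proximal mapping, hence firmly nonexpansive, hence
  monotone, which closes the circle. Finally \<open>env f + env f\<^sup>* = \<parallel>\<cdot>\<parallel>\<^sup>2/2\<close> makes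
  \<open>env g\<^sup>* - env f\<^sup>*\<close> the same function as \<open>env f - env g\<close>.
\<close>

section \<open>Functions squeezed between an affine function and a unit paraboloid\<close>

definition envelope_gradient :: "('a::real_inner \<Rightarrow> real) \<Rightarrow> ('a \<Rightarrow> 'a) \<Rightarrow> bool" where
  "envelope_gradient h G \<longleftrightarrow>
    (\<forall>x y. h x + (y - x) \<bullet> G x \<le> h y \<and> h y \<le> h x + (y - x) \<bullet> G x + (1/2) * (norm (y - x))\<^sup>2)"

lemma envelope_gradientD:
  assumes "envelope_gradient h G"
  shows "h x + (y - x) \<bullet> G x \<le> h y"
    and "h y \<le> h x + (y - x) \<bullet> G x + (1/2) * (norm (y - x))\<^sup>2"
  using assms by (auto simp: envelope_gradient_def)

text \<open>
  The map \<open>h \<mapsto> \<parallel>\<cdot>\<parallel>\<^sup>2/2 - h\<close> exchanges the two bounds, because \<open>\<parallel>\<cdot>\<parallel>\<^sup>2/2\<close> differs from its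
  linearization at \<open>x\<close> by exactly \<open>\<parallel>\<cdot> - x\<parallel>\<^sup>2/2\<close>.
\<close>

lemma envelope_gradient_half_square_diff:
  assumes "envelope_gradient h G"
  shows "envelope_gradient (\<lambda>x. (1/2) * (norm x)\<^sup>2 - h x) (\<lambda>x. x - G x)"
proof -
  have sq: "(norm y)\<^sup>2 = (norm x)\<^sup>2 + 2 * ((y - x) \<bullet> x) + (norm (y - x))\<^sup>2" for x y :: 'a
    by (simp add: power2_norm_eq_inner inner_diff_left inner_diff_right inner_commute)
  show ?thesis
    unfolding envelope_gradient_def
  proof (intro allI conjI)
    fix x y
    show "(1/2) * (norm x)\<^sup>2 - h x + (y - x) \<bullet> (x - G x) \<le> (1/2) * (norm y)\<^sup>2 - h y"
      using envelope_gradientD(2)[OF assms, of y x] sq[of y x]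
      unfolding inner_diff_right[of _ x] by argo
    show "(1/2) * (norm y)\<^sup>2 - h y
        \<le> (1/2) * (norm x)\<^sup>2 - h x + (y - x) \<bullet> (x - G x) + (1/2) * (norm (y - x))\<^sup>2"
      using envelope_gradientD(1)[OF assms, of x y] sq[of y x]
      unfolding inner_diff_right[of _ x] by argo
  qed
qed

lemma convex_on_if_subgradients:
  fixes h :: "'a::real_inner \<Rightarrow> real"
  assumes sub: "\<And>x y. h x + (y - x) \<bullet> G x \<le> h y"
  shows "convex_on UNIV h"
proof (rule convex_onI)
  fix t :: real and x y :: 'a
  assume t: "0 < t" "t < 1"
  define z where "z = (1 - t) *\<^sub>R x + t *\<^sub>R y"
  have "(1 - t) * (h z + (x - z) \<bullet> G z) + t * (h z + (y - z) \<bullet> G z) \<le> (1 - t) * h x + t * h y"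
    using t by (intro add_mono mult_left_mono sub) auto
  moreover have "(1 - t) * ((x - z) \<bullet> G z) + t * ((y - z) \<bullet> G z) = 0"
  proof -
    have "(1 - t) *\<^sub>R (x - z) + t *\<^sub>R (y - z) = 0"
      by (simp add: z_def algebra_simps)
    then show ?thesis
      by (metis inner_add_left inner_scaleR_left inner_zero_left)
  qed
  ultimately show "h ((1 - t) *\<^sub>R x + t *\<^sub>R y) \<le> (1 - t) * h x + t * h y"
    unfolding z_def[symmetric] by (simp add: algebra_simps)
qed auto

text \<open>
  Divide by \<open>t\<close> and let \<open>t\<close> tend to \<open>0\<close>. This turns an estimate along a segment with a quadratic
  error into a first-order one.
\<close>

lemma le_if_quadratic_perturbation:
  fixes A B C :: real
  assumes "\<And>t. 0 < t \<Longrightarrow> t < 1 \<Longrightarrow> t * A \<le> t * B + t\<^sup>2 * C"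
  shows "A \<le> B"
proof (rule tendsto_lowerbound)
  show "((\<lambda>t. B + t * C) \<longlongrightarrow> B) (at_right 0)"
    by (rule tendsto_eq_intros refl | simp)+
  have "A \<le> B + t * C" if "0 < t" "t < 1" for t
  proof -
    have "t * A \<le> t * (B + t * C)"
      using assms[OF that] by (simp add: power2_eq_square algebra_simps)
    then show ?thesis using that by simp
  qed
  then show "\<forall>\<^sub>F t in at_right 0. A \<le> B + t * C"
    unfolding eventually_at_right_field by (metis zero_less_one)
qed auto

text \<open>
  For a convex function, an affine minorant up to a quadratic error is an affine minorant: moving
  from \<open>x\<close> towards \<open>y\<close> by a factor \<open>t\<close> scales the linear terms by \<open>t\<close> but the error by \<open>t\<^sup>2\<close>.
\<close>

lemma subgradient_if_convex_on:
  fixes h :: "'a::real_inner \<Rightarrow> real"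
  assumes cvx: "convex_on UNIV h"
    and low: "\<And>y. h x + (y - x) \<bullet> u - C * (norm (y - x))\<^sup>2 \<le> h y"
  shows "h x + (y - x) \<bullet> u \<le> h y"
proof -
  have "(y - x) \<bullet> u \<le> h y - h x"
  proof (rule le_if_quadratic_perturbation)
    fix t :: real assume t: "0 < t" "t < 1"
    define z where "z = (1 - t) *\<^sub>R x + t *\<^sub>R y"
    have zx: "z - x = t *\<^sub>R (y - x)" by (simp add: z_def algebra_simps)
    have "h z \<le> (1 - t) * h x + t * h y"
      unfolding z_def using t by (intro convex_onD[OF cvx]) auto
    moreover have "h x + t * ((y - x) \<bullet> u) - C * (t\<^sup>2 * (norm (y - x))\<^sup>2) \<le> h z"
      using low[of z] unfolding zx by (simp add: power_mult_distrib)
    ultimately show "t * ((y - x) \<bullet> u) \<le> t * (h y - h x) + t\<^sup>2 * (C * (norm (y - x))\<^sup>2)"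
      by (simp add: algebra_simps)
  qed
  then show ?thesis by simp
qed

text \<open>
  The quadratic bound makes \<open>G\<close> the gradient of \<open>h\<close>. Along the segment from \<open>x\<close> to \<open>y\<close>,
  monotonicity says that \<open>h\<close> minus its linearization at \<open>x\<close> has a nonnegative derivative.
\<close>

lemma subgradient_if_monotone_gradient:
  fixes h :: "'a::real_inner \<Rightarrow> real"
  assumes mono: "monotone_operator G"
    and quad: "\<And>x y. \<bar>h y - h x - (y - x) \<bullet> G x\<bar> \<le> (1/2) * (norm (y - x))\<^sup>2"
  shows "h x + (y - x) \<bullet> G x \<le> h y"
proof -
  define z where "z = (\<lambda>t::real. x + t *\<^sub>R (y - x))"
  define \<phi> where "\<phi> = (\<lambda>t. h (z t) - t * ((y - x) \<bullet> G x))"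
  have deriv: "(\<phi> has_real_derivative (y - x) \<bullet> G (z t) - (y - x) \<bullet> G x) (at t)" for t
  proof -
    have "((\<lambda>t. h (z t)) has_real_derivative (y - x) \<bullet> G (z t)) (at t)"
      unfolding has_field_derivative_iff
    proof (rule tendsto_0_le[where K = 1, THEN LIM_zero_cancel])
      show "((\<lambda>s. (1/2) * (norm (y - x))\<^sup>2 * \<bar>s - t\<bar>) \<longlongrightarrow> 0) (at t)"
        by (rule tendsto_eq_intros refl | simp)+
      show "\<forall>\<^sub>F s in at t. norm ((h (z s) - h (z t)) / (s - t) - (y - x) \<bullet> G (z t))
          \<le> norm ((1/2) * (norm (y - x))\<^sup>2 * \<bar>s - t\<bar>) * 1"
      proof (rule eventually_at_filter[THEN iffD2], rule always_eventually, intro allI impI)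
        fix s assume "s \<noteq> t"
        have zz: "z s - z t = (s - t) *\<^sub>R (y - x)" by (simp add: z_def algebra_simps)
        have "\<bar>h (z s) - h (z t) - (s - t) * ((y - x) \<bullet> G (z t))\<bar>
            \<le> (1/2) * ((s - t)\<^sup>2 * (norm (y - x))\<^sup>2)"
          using quad[where y = "z s" and x = "z t"] unfolding zz by (simp add: power_mult_distrib)
        also have "\<dots> = ((1/2) * (norm (y - x))\<^sup>2 * \<bar>s - t\<bar>) * \<bar>s - t\<bar>"
          by (simp add: power2_eq_square)
        finally have le: "\<bar>h (z s) - h (z t) - (s - t) * ((y - x) \<bullet> G (z t))\<bar>
            \<le> ((1/2) * (norm (y - x))\<^sup>2 * \<bar>s - t\<bar>) * \<bar>s - t\<bar>" .
        have "(h (z s) - h (z t)) / (s - t) - (y - x) \<bullet> G (z t)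
            = (h (z s) - h (z t) - (s - t) * ((y - x) \<bullet> G (z t))) / (s - t)"
          using \<open>s \<noteq> t\<close> by (simp add: field_simps)
        then show "norm ((h (z s) - h (z t)) / (s - t) - (y - x) \<bullet> G (z t))
            \<le> norm ((1/2) * (norm (y - x))\<^sup>2 * \<bar>s - t\<bar>) * 1"
          using le \<open>s \<noteq> t\<close> by (simp add: abs_divide divide_le_eq abs_mult)
      qed
    qed
    then show ?thesis
      unfolding \<phi>_def by (auto intro!: derivative_eq_intros)
  qed
  have "\<phi> 0 \<le> \<phi> 1"
  proof (rule DERIV_nonneg_imp_nondecreasing[where f = \<phi>])
    fix t :: real assume t: "0 \<le> t" "t \<le> 1"
    have "0 \<le> (z t - x) \<bullet> (G (z t) - G x)"
      using mono by (simp add: monotone_operator_def)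
    then have "0 \<le> t * ((y - x) \<bullet> G (z t) - (y - x) \<bullet> G x)"
      by (simp add: z_def inner_diff_right right_diff_distrib)
    then have "0 \<le> (y - x) \<bullet> G (z t) - (y - x) \<bullet> G x"
      using t by (cases "t = 0") (auto simp: z_def zero_le_mult_iff)
    then show "\<exists>D. (\<phi> has_real_derivative D) (at t) \<and> D \<ge> 0"
      using deriv by blast
  qed simp
  then show ?thesis by (simp add: \<phi>_def z_def)
qed

lemma continuous_if_envelope_gradient:
  assumes "envelope_gradient h G"
  shows "(h \<longlongrightarrow> h x) (at x)"
proof (rule tendsto_sandwich)
  show "\<forall>\<^sub>F y in at x. h x + (y - x) \<bullet> G x \<le> h y"
    and "\<forall>\<^sub>F y in at x. h y \<le> h x + (y - x) \<bullet> G x + (1/2) * (norm (y - x))\<^sup>2"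
    using envelope_gradientD[OF assms] by simp_all
  show "((\<lambda>y. h x + (y - x) \<bullet> G x) \<longlongrightarrow> h x) (at x)"
    by (rule tendsto_eq_intros refl | simp)+
  show "((\<lambda>y. h x + (y - x) \<bullet> G x + (1/2) * (norm (y - x))\<^sup>2) \<longlongrightarrow> h x) (at x)"
    by (rule tendsto_eq_intros refl | simp)+
qed

section \<open>Functions in \<open>\<Gamma>\<^sub>0\<close>\<close>

lemma lower_semicontinuous_iff_eventually:
  "lower_semicontinuous f \<longleftrightarrow> (\<forall>x c. c < f x \<longrightarrow> (\<forall>\<^sub>F y in nhds x. c < f y))"
  by (auto simp: lower_semicontinuous_def le_Liminf_iff eventually_nhds_conv_at)

lemma Gamma0_epi_convex:
  assumes "f \<in> Gamma0" and "(x, a) \<in> epi f" and "(y, b) \<in> epi f" and "0 \<le> t" and "t \<le> 1"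
  shows "((1 - t) *\<^sub>R x + t *\<^sub>R y, (1 - t) * a + t * b) \<in> epi f"
proof -
  have "convex (epi f)" using assms(1) by (simp add: Gamma0_def convex_fun_def)
  then have "(1 - t) *\<^sub>R (x, a) + t *\<^sub>R (y, b) \<in> epi f"
    using assms unfolding convex_alt by blast
  then show ?thesis by simp
qed

lemma Gamma0_finite_point:
  assumes "f \<in> Gamma0"
  obtains x a where "f x = ereal a"
proof -
  from assms obtain x where "f x \<noteq> -\<infinity>" "f x \<noteq> \<infinity>"
    by (auto simp: Gamma0_def proper_fun_def)
  then show thesis using that by (cases "f x") auto
qed

text \<open>
  Lower semicontinuity bounds \<open>f\<close> from below on a ball around a point of its domain; convexity,
  applied where a segment from the centre leaves a smaller ball, then forbids \<open>f\<close> to decrease faster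
  than linearly. This minorant makes \<open>f + \<parallel>x - \<cdot>\<parallel>\<^sup>2/2\<close> bounded below.
\<close>

lemma Gamma0_norm_minorant:
  assumes f: "f \<in> Gamma0"
  obtains y0 a C where "\<forall>(y, r)\<in>epi f. a - C * norm (y - y0) \<le> r"
proof -
  obtain y0 a0 where y0: "f y0 = ereal a0" using Gamma0_finite_point[OF f] .
  have "\<forall>\<^sub>F y in nhds y0. ereal (a0 - 1) < f y"
    using f y0 unfolding Gamma0_def lower_semicontinuous_iff_eventually by auto
  then obtain \<delta> where \<delta>: "\<delta> > 0" "\<And>y. dist y y0 < \<delta> \<Longrightarrow> ereal (a0 - 1) < f y"
    unfolding eventually_nhds_metric by blast
  define d where "d = \<delta> / 2"
  have d: "0 < d" "d < \<delta>" using \<delta>(1) by (auto simp: d_def)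
  show thesis
  proof (rule that[of "a0 - 1" "1 / d" y0], clarify)
    fix y r assume yr: "(y, r) \<in> epi f"
    show "a0 - 1 - 1 / d * norm (y - y0) \<le> r"
    proof (cases "norm (y - y0) \<le> d")
      case True
      then have "ereal (a0 - 1) < f y" using \<delta>(2)[of y] d by (simp add: dist_norm)
      also have "f y \<le> ereal r" using yr by (simp add: epi_def)
      finally have "a0 - 1 < r" by simp
      moreover have "0 \<le> 1 / d * norm (y - y0)" using d by simp
      ultimately show ?thesis by auto
    next
      case False
      define n where "n = norm (y - y0)"
      have n: "d < n" "0 < n" using False d by (auto simp: n_def)
      define t where "t = d / n"
      have t: "0 < t" "t < 1" "t * n = d" using n d by (auto simp: t_def)
      define z where "z = (1 - t) *\<^sub>R y0 + t *\<^sub>R y"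
      have "z - y0 = t *\<^sub>R (y - y0)" by (simp add: z_def algebra_simps)
      then have "dist z y0 = d" using t by (simp add: dist_norm n_def)
      then have "ereal (a0 - 1) < f z" using \<delta>(2) d by simp
      also have "f z \<le> ereal ((1 - t) * a0 + t * r)"
        using Gamma0_epi_convex[OF f _ yr, of y0 a0 t] t y0 by (simp add: epi_def z_def)
      finally have "t * a0 - 1 < t * r" by (simp add: algebra_simps)
      moreover have "t * (a0 - n / d) = t * a0 - 1" using d n by (simp add: t_def right_diff_distrib)
      ultimately have "t * (a0 - n / d) < t * r" by simp
      then have "a0 - n / d < r" using t by simp
      then show ?thesis by (simp add: n_def)
    qed
  qed
qed

lemma norm_diff_scaleR_square:
  fixes a b :: "'a::real_inner"
  shows "(norm (a - t *\<^sub>R b))\<^sup>2 = (norm a)\<^sup>2 - 2 * t * (b \<bullet> a) + t\<^sup>2 * (norm b)\<^sup>2"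
  unfolding power2_norm_eq_inner
  by (simp add: inner_diff_left inner_diff_right inner_commute power2_eq_square)

lemma norm_midpoint_identity:
  fixes x y z :: "'a::real_inner"
  shows "(norm (x - ((1/2) *\<^sub>R y + (1/2) *\<^sub>R z)))\<^sup>2
    = (1/2) * (norm (x - y))\<^sup>2 + (1/2) * (norm (x - z))\<^sup>2 - (1/4) * (norm (y - z))\<^sup>2"
proof -
  have y: "(1/2) *\<^sub>R y + (1/2) *\<^sub>R y = y"
    by (simp flip: scaleR_add_left)
  have "x - ((1/2) *\<^sub>R y + (1/2) *\<^sub>R z)
      = (x - ((1/2) *\<^sub>R y + (1/2) *\<^sub>R y)) - (1/2) *\<^sub>R (z - y)"
    by (simp only: scaleR_diff_right) simp
  then have mid: "x - ((1/2) *\<^sub>R y + (1/2) *\<^sub>R z) = (x - y) - (1/2) *\<^sub>R (z - y)"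
    unfolding y .
  have z: "x - z = (x - y) - 1 *\<^sub>R (z - y)" by simp
  show ?thesis
    unfolding mid z norm_diff_scaleR_square norm_minus_commute[of y z]
    by (simp add: power2_eq_square add_divide_distrib diff_divide_distrib)
qed

text \<open>
  The infimum of \<open>f + \<parallel>x - \<cdot>\<parallel>\<^sup>2/2\<close> is attained: by the midpoint identity, convexity of \<open>f\<close> makes
  every minimizing sequence Cauchy, and lower semicontinuity transfers the bound to its limit.
  Minimizing over the epigraph instead of the domain keeps all values real.
\<close>

lemma Gamma0_proximal_minimizer:
  fixes f :: "'a::{real_inner, banach} \<Rightarrow> ereal"
  assumes f: "f \<in> Gamma0"
  obtains p a where "(p, a) \<in> epi f"
    and "\<forall>(y, r)\<in>epi f. a + (1/2) * (norm (x - p))\<^sup>2 \<le> r + (1/2) * (norm (x - y))\<^sup>2"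
proof -
  define F where "F = (\<lambda>(y, r). r + (1/2) * (norm (x - y))\<^sup>2)"
  define m where "m = Inf (F ` epi f)"
  obtain y0 a0 where "f y0 = ereal a0" using Gamma0_finite_point[OF f] .
  then have "(y0, a0) \<in> epi f" by (simp add: epi_def)
  then have ne: "epi f \<noteq> {}" by blast
  have bdd: "bdd_below (F ` epi f)"
  proof -
    obtain y1 a C where minorant: "\<forall>(y, r)\<in>epi f. a - C * norm (y - y1) \<le> r"
      using Gamma0_norm_minorant[OF f] .
    have "a - \<bar>C\<bar> * norm (x - y1) - (1/2) * C\<^sup>2 \<le> F (y, r)" if "(y, r) \<in> epi f" for y r
    proof -
      have "norm (y - y1) \<le> norm (x - y1) + norm (x - y)"
        using norm_triangle_ineq4[of "x - y1" "x - y"] by simp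
      then have "\<bar>C\<bar> * norm (y - y1) \<le> \<bar>C\<bar> * (norm (x - y1) + norm (x - y))"
        by (rule mult_left_mono) simp
      moreover have "C * norm (y - y1) \<le> \<bar>C\<bar> * norm (y - y1)"
        by (rule mult_right_mono) auto
      moreover have "0 \<le> (norm (x - y))\<^sup>2 + C\<^sup>2 - 2 * (\<bar>C\<bar> * norm (x - y))"
        using zero_le_power2[of "norm (x - y) - \<bar>C\<bar>"] by (simp add: power2_diff mult_ac)
      ultimately show ?thesis
        using bspec[OF minorant that] unfolding F_def distrib_left prod.case by linarith
    qed
    then show ?thesis by (intro bdd_belowI[of _ "a - \<bar>C\<bar> * norm (x - y1) - (1/2) * C\<^sup>2"]) auto
  qed
  have m_le: "m \<le> r + (1/2) * (norm (x - y))\<^sup>2" if "(y, r) \<in> epi f" for y r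
  proof -
    have "m \<le> F (y, r)" unfolding m_def using that by (intro cInf_lower bdd imageI)
    then show ?thesis by (simp add: F_def)
  qed
  have "\<exists>w\<in>epi f. F w < m + inverse (real (Suc n))" for n
    using cInf_lessD[of "F ` epi f" "m + inverse (real (Suc n))"] ne by (auto simp: m_def)
  then obtain w where w: "\<And>n. w n \<in> epi f" "\<And>n. F (w n) < m + inverse (real (Suc n))"
    by metis
  define y r where "y = (\<lambda>n. fst (w n))" and "r = (\<lambda>n. snd (w n))"
  have yr: "(y n, r n) \<in> epi f" "r n + (1/2) * (norm (x - y n))\<^sup>2 < m + inverse (real (Suc n))" for n
    using w[of n] by (auto simp: y_def r_def F_def case_prod_beta)
  define \<epsilon> where "\<epsilon> = (\<lambda>n. inverse (real (Suc n)))"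
  have near: "r n + (1/2) * (norm (x - y n))\<^sup>2 < m + \<epsilon> n" for n
    using yr(2)[of n] by (simp only: \<epsilon>_def)
  have close: "(norm (y i - y j))\<^sup>2 \<le> 4 * \<epsilon> i + 4 * \<epsilon> j" for i j
  proof -
    have "((1/2) *\<^sub>R y i + (1/2) *\<^sub>R y j, (1/2) * r i + (1/2) * r j) \<in> epi f"
      using Gamma0_epi_convex[OF f yr(1)[of i] yr(1)[of j], of "1/2"] by simp
    from m_le[OF this] have "m \<le> (1/2) * (r i + (1/2) * (norm (x - y i))\<^sup>2)
        + (1/2) * (r j + (1/2) * (norm (x - y j))\<^sup>2) - (norm (y i - y j))\<^sup>2 / 8"
      unfolding norm_midpoint_identity by (simp add: add_divide_distrib diff_divide_distrib)
    then show ?thesis using near[of i] near[of j] by argo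
  qed
  have "Cauchy y"
  proof (rule metric_CauchyI)
    fix e :: real assume e: "0 < e"
    then obtain N where N: "\<epsilon> N < e\<^sup>2 / 8"
      using reals_Archimedean[of "e\<^sup>2 / 8"] by (auto simp: \<epsilon>_def)
    have "dist (y i) (y j) < e" if "i \<ge> N" "j \<ge> N" for i j
    proof -
      have "\<epsilon> i \<le> \<epsilon> N" "\<epsilon> j \<le> \<epsilon> N"
        using that by (auto simp: \<epsilon>_def intro!: le_imp_inverse_le)
      then have "(norm (y i - y j))\<^sup>2 < e\<^sup>2" using close[of i j] N by linarith
      then show ?thesis using e by (simp add: dist_norm power_less_imp_less_base)
    qed
    then show "\<exists>M. \<forall>i\<ge>M. \<forall>j\<ge>M. dist (y i) (y j) < e" by blast
  qed
  then obtain p where p: "y \<longlonglongrightarrow> p" by (auto simp: Cauchy_convergent_iff convergent_def)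
  define a where "a = m - (1/2) * (norm (x - p))\<^sup>2"
  have "f p \<le> ereal a"
  proof (rule ccontr)
    assume "\<not> f p \<le> ereal a"
    then have "ereal a < f p" by simp
    then obtain c where c: "ereal a < ereal c" "ereal c < f p"
      using ereal_dense2 by blast
    have "\<forall>\<^sub>F z in nhds p. ereal c < f z"
      using f c(2) unfolding Gamma0_def lower_semicontinuous_iff_eventually by auto
    then have ev: "\<forall>\<^sub>F n in sequentially. ereal c < f (y n)"
      using p unfolding filterlim_iff by blast
    have "c \<le> a"
    proof (rule tendsto_lowerbound)
      have "(\<lambda>n. m + inverse (real (Suc n)) - (1/2) * (norm (x - y n))\<^sup>2)
          \<longlonglongrightarrow> m + 0 - (1/2) * (norm (x - p))\<^sup>2"
        by (intro tendsto_intros p LIMSEQ_inverse_real_of_nat)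
      then show "(\<lambda>n. m + inverse (real (Suc n)) - (1/2) * (norm (x - y n))\<^sup>2) \<longlonglongrightarrow> a"
        by (simp add: a_def)
      show "\<forall>\<^sub>F n in sequentially. c \<le> m + inverse (real (Suc n)) - (1/2) * (norm (x - y n))\<^sup>2"
        using ev
      proof eventually_elim
        case (elim n)
        note elim
        also have "f (y n) \<le> ereal (r n)" using yr(1)[of n] by (simp add: epi_def)
        finally have "c < r n" by simp
        then show ?case using yr(2)[of n] by simp
      qed
    qed simp
    then show False using c(1) by simp
  qed
  then show thesis
    using m_le by (intro that[of p a]) (auto simp: epi_def a_def)
qed

text \<open>
  This is Fermat's rule at the minimizer of \<open>f + \<parallel>x - \<cdot>\<parallel>\<^sup>2/2\<close>, obtained by comparing the
  minimizer \<open>p\<close> with the points \<open>p + t (y - p)\<close> for small \<open>t\<close>.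
\<close>

lemma resolvent_inclusion_exists:
  fixes f :: "'a::{real_inner, banach} \<Rightarrow> ereal"
  assumes f: "f \<in> Gamma0"
  shows "\<exists>p. x - p \<in> subdifferential f p"
proof -
  obtain p a where pa: "(p, a) \<in> epi f"
    and min: "\<forall>(y, r)\<in>epi f.
      a + (1/2) * (norm (x - p))\<^sup>2 \<le> r + (1/2) * (norm (x - y))\<^sup>2"
    using Gamma0_proximal_minimizer[OF f, where x = x] .
  have epi_sub: "a + (y - p) \<bullet> (x - p) \<le> b" if yb: "(y, b) \<in> epi f" for y b
  proof -
    have "(y - p) \<bullet> (x - p) \<le> b - a"
    proof (rule le_if_quadratic_perturbation)
      fix t :: real assume t: "0 < t" "t < 1"
      have "x - ((1 - t) *\<^sub>R p + t *\<^sub>R y) = (x - p) - t *\<^sub>R (y - p)"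
        by (simp add: algebra_simps)
      then have "(norm (x - ((1 - t) *\<^sub>R p + t *\<^sub>R y)))\<^sup>2
          = (norm (x - p))\<^sup>2 - 2 * t * ((y - p) \<bullet> (x - p)) + t\<^sup>2 * (norm (y - p))\<^sup>2"
        by (simp only: norm_diff_scaleR_square)
      then show "t * ((y - p) \<bullet> (x - p)) \<le> t * (b - a) + t\<^sup>2 * ((1/2) * (norm (y - p))\<^sup>2)"
        using bspec[OF min Gamma0_epi_convex[OF f pa yb, of t]] t by (simp add: left_diff_distrib right_diff_distrib
            add_divide_distrib diff_divide_distrib)
    qed
    then show ?thesis by simp
  qed
  have "f p + ereal ((y - p) \<bullet> (x - p)) \<le> f y" for y
  proof -
    have "f p + ereal ((y - p) \<bullet> (x - p)) \<le> ereal (a + (y - p) \<bullet> (x - p))"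
      using add_right_mono[of "f p" "ereal a" "ereal ((y - p) \<bullet> (x - p))"] pa by (simp add: epi_def)
    also have "\<dots> \<le> f y"
      using f epi_sub[of y] by (cases "f y") (auto simp: epi_def Gamma0_def proper_fun_def)
    finally show ?thesis .
  qed
  then show ?thesis by (auto simp: subdifferential_def)
qed

lemma subdifferential_finite:
  assumes f: "f \<in> Gamma0" and u: "u \<in> subdifferential f p"
  obtains a where "f p = ereal a"
proof -
  obtain y b where y: "f y = ereal b" using Gamma0_finite_point[OF f] .
  have "f p + ereal ((y - p) \<bullet> u) \<le> f y" using u by (simp add: subdifferential_def)
  moreover have "f p \<noteq> -\<infinity>" using f by (auto simp: Gamma0_def proper_fun_def)
  ultimately show thesis using that y by (cases "f p") auto
qed

lemma subdifferential_monotone: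
  assumes f: "f \<in> Gamma0" and u: "u \<in> subdifferential f p" and v: "v \<in> subdifferential f q"
  shows "0 \<le> (p - q) \<bullet> (u - v)"
proof -
  obtain a where a: "f p = ereal a" using subdifferential_finite[OF f u] .
  obtain b where b: "f q = ereal b" using subdifferential_finite[OF f v] .
  have "f p + ereal ((q - p) \<bullet> u) \<le> f q" "f q + ereal ((p - q) \<bullet> v) \<le> f p"
    using u v by (simp_all add: subdifferential_def)
  then show ?thesis by (simp add: a b inner_diff_left inner_diff_right)
qed

lemma prox_eqI:
  assumes f: "f \<in> Gamma0" and p: "x - p \<in> subdifferential f p"
  shows "prox f x = p"
  unfolding prox_def
proof (rule the_equality)
  show "x \<in> {p + u |u. u \<in> subdifferential f p}" using p by force
next
  fix q assume "x \<in> {q + u |u. u \<in> subdifferential f q}"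
  then have "x - q \<in> subdifferential f q" by auto
  from subdifferential_monotone[OF f this p] have "(q - p) \<bullet> (q - p) \<le> 0"
    by (simp add: algebra_simps)
  then show "q = p" by (metis inner_gt_zero_iff leD right_minus_eq)
qed

lemma prox_subgradient:
  fixes f :: "'a::{real_inner, banach} \<Rightarrow> ereal"
  assumes "f \<in> Gamma0"
  shows "x - prox f x \<in> subdifferential f (prox f x)"
  using resolvent_inclusion_exists[OF assms] prox_eqI[OF assms] by metis

lemma prox_firmly_nonexpansive:
  fixes f :: "'a::{real_inner, banach} \<Rightarrow> ereal"
  assumes f: "f \<in> Gamma0"
  shows "prox f \<in> firmly_nonexpansive_maps"
proof -
  have "(norm (prox f x - prox f y))\<^sup>2 \<le> (x - y) \<bullet> (prox f x - prox f y)" for x y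
    using subdifferential_monotone[OF f prox_subgradient[OF f, of x] prox_subgradient[OF f, of y]]
    by (simp add: power2_norm_eq_inner inner_diff_left inner_diff_right inner_commute
        add_divide_distrib diff_divide_distrib)
  then show ?thesis by (simp add: firmly_nonexpansive_maps_def)
qed

section \<open>Moreau envelopes\<close>

lemma env_eqI:
  assumes a: "f p = ereal a" and p: "x - p \<in> subdifferential f p"
  shows "env f x = ereal (a + (1/2) * (norm (x - p))\<^sup>2)"
  unfolding env_def
proof (rule antisym)
  show "(INF y. f y + ereal ((1/2) * (norm (x - y))\<^sup>2)) \<le> ereal (a + (1/2) * (norm (x - p))\<^sup>2)"
    by (rule INF_lower2[of p]) (auto simp: a)
  show "ereal (a + (1/2) * (norm (x - p))\<^sup>2) \<le> (INF y. f y + ereal ((1/2) * (norm (x - y))\<^sup>2))"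
  proof (rule INF_greatest)
    fix y
    have "0 \<le> (norm (y - p))\<^sup>2" by simp
    also have "(norm (y - p))\<^sup>2
        = 2 * ((y - p) \<bullet> (x - p)) + (norm (x - y))\<^sup>2 - (norm (x - p))\<^sup>2"
      by (simp add: power2_norm_eq_inner inner_diff_left inner_diff_right inner_commute
        add_divide_distrib diff_divide_distrib)
    finally have "ereal (a + (1/2) * (norm (x - p))\<^sup>2)
        \<le> (f p + ereal ((y - p) \<bullet> (x - p))) + ereal ((1/2) * (norm (x - y))\<^sup>2)"
      by (simp add: a)
    also have "\<dots> \<le> f y + ereal ((1/2) * (norm (x - y))\<^sup>2)"
      using p by (intro add_right_mono) (auto simp: subdifferential_def)
    finally show "ereal (a + (1/2) * (norm (x - p))\<^sup>2) \<le> f y + ereal ((1/2) * (norm (x - y))\<^sup>2)" .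
  qed
qed

text \<open>
  Moreau's decomposition of \<open>\<parallel>x\<parallel>\<^sup>2/2\<close>. The infimum defining the envelope of \<open>f\<^sup>*\<close> is attained at
  \<open>x - p\<close>: there the Fenchel-Young inequality is an equality, and elsewhere its version with the fixed
  point \<open>p\<close> leaves the minimization of \<open>p \<bullet> u + \<parallel>x - u\<parallel>\<^sup>2/2\<close>.
\<close>

lemma env_conjugate_eqI:
  assumes a: "f p = ereal a" and p: "x - p \<in> subdifferential f p"
  shows "env (fenchel_conjugate f) x
    = ereal ((1/2) * (norm x)\<^sup>2 - (a + (1/2) * (norm (x - p))\<^sup>2))"
  unfolding env_def
proof (rule antisym)
  define R where "R = (1/2) * (norm x)\<^sup>2 - (a + (1/2) * (norm (x - p))\<^sup>2)"
  have R: "p \<bullet> (x - p) - a + (1/2) * (norm p)\<^sup>2 = R"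
    by (simp add: R_def power2_norm_eq_inner inner_diff_left inner_diff_right inner_commute
        add_divide_distrib diff_divide_distrib)
  have "fenchel_conjugate f (x - p) \<le> ereal (p \<bullet> (x - p) - a)"
    unfolding fenchel_conjugate_def
  proof (rule SUP_least)
    fix y
    have "ereal (a + (y - p) \<bullet> (x - p)) \<le> f y"
      using p a by (auto simp: subdifferential_def)
    then show "ereal (y \<bullet> (x - p)) - f y \<le> ereal (p \<bullet> (x - p) - a)"
      by (cases "f y") (auto simp: inner_diff_left)
  qed
  then have "fenchel_conjugate f (x - p) + ereal ((1/2) * (norm (x - (x - p)))\<^sup>2)
      \<le> ereal (p \<bullet> (x - p) - a) + ereal ((1/2) * (norm p)\<^sup>2)"
    by (intro add_mono) auto
  also have "\<dots> = ereal R" using R by simp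
  finally show "(INF u. fenchel_conjugate f u + ereal ((1/2) * (norm (x - u))\<^sup>2)) \<le> ereal R"
    by (rule INF_lower2[OF UNIV_I])
  show "ereal R \<le> (INF u. fenchel_conjugate f u + ereal ((1/2) * (norm (x - u))\<^sup>2))"
  proof (rule INF_greatest)
    fix u
    have "ereal (p \<bullet> u) - f p \<le> fenchel_conjugate f u"
      unfolding fenchel_conjugate_def by (rule SUP_upper) simp
    then have "ereal (p \<bullet> u - a) + ereal ((1/2) * (norm (x - u))\<^sup>2)
        \<le> fenchel_conjugate f u + ereal ((1/2) * (norm (x - u))\<^sup>2)"
      by (intro add_right_mono) (simp add: a)
    moreover have "R \<le> p \<bullet> u - a + (1/2) * (norm (x - u))\<^sup>2"
    proof -
      have "0 \<le> (norm (x - u - p))\<^sup>2" by simp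
      then show ?thesis
        by (simp add: R_def power2_norm_eq_inner inner_diff_left inner_diff_right inner_commute
        add_divide_distrib diff_divide_distrib)
    qed
    ultimately show "ereal R \<le> fenchel_conjugate f u + ereal ((1/2) * (norm (x - u))\<^sup>2)"
      by (auto intro: order_trans[rotated])
  qed
qed

text \<open>
  With \<open>u = x - P x\<close> and \<open>v = y - P y\<close>, the subgradient inequality of \<open>f\<close> between \<open>P x\<close> and
  \<open>P y\<close> gives the lower bound with \<open>\<parallel>v - u\<parallel>\<^sup>2/2\<close> to spare; using \<open>P x\<close> as a competitor in the
  infimum that defines the envelope at \<open>y\<close> gives the upper bound.
\<close>

lemma Gamma0_envelope:
  fixes f :: "'a::{real_inner, banach} \<Rightarrow> ereal"
  assumes f: "f \<in> Gamma0"
  obtains e where "env f = (\<lambda>x. ereal (e x))"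
    and "env (fenchel_conjugate f) = (\<lambda>x. ereal ((1/2) * (norm x)\<^sup>2 - e x))"
    and "envelope_gradient e (\<lambda>x. x - prox f x)"
proof -
  let ?P = "prox f"
  have "\<exists>a. f (?P x) = ereal a" for x
    using subdifferential_finite[OF f prox_subgradient[OF f]] by metis
  then obtain a where a: "\<And>x. f (?P x) = ereal (a x)" by metis
  define e where "e = (\<lambda>x. a x + (1/2) * (norm (x - ?P x))\<^sup>2)"
  have env: "env f x = ereal (e x)" for x
    unfolding e_def by (rule env_eqI[OF a prox_subgradient[OF f]])
  have env': "env (fenchel_conjugate f) x = ereal ((1/2) * (norm x)\<^sup>2 - e x)" for x
    unfolding e_def by (rule env_conjugate_eqI[OF a prox_subgradient[OF f]])
  have "envelope_gradient e (\<lambda>x. x - ?P x)"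
    unfolding envelope_gradient_def
  proof (intro allI conjI)
    fix x y
    define u v where "u = x - ?P x" and "v = y - ?P y"
    have "f (?P x) + ereal ((?P y - ?P x) \<bullet> u) \<le> f (?P y)"
      using prox_subgradient[OF f, of x] by (auto simp: subdifferential_def u_def)
    then have "a x + (?P y - ?P x) \<bullet> u \<le> a y" by (simp add: a)
    moreover have "?P y - ?P x = (y - x) - (v - u)" by (simp add: u_def v_def)
    moreover have "0 \<le> (norm (v - u))\<^sup>2" by simp
    ultimately show "e x + (y - x) \<bullet> (x - ?P x) \<le> e y"
      unfolding e_def u_def[symmetric] v_def[symmetric]
      by (simp add: power2_norm_eq_inner inner_diff_left inner_diff_right inner_commute
        add_divide_distrib diff_divide_distrib)
    have "ereal (e y) \<le> f (?P x) + ereal ((1/2) * (norm (y - ?P x))\<^sup>2)"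
      unfolding env[symmetric] env_def by (rule INF_lower) simp
    then have "e y \<le> a x + (1/2) * (norm ((y - x) + u))\<^sup>2" by (simp add: a u_def)
    then show "e y \<le> e x + (y - x) \<bullet> (x - ?P x) + (1/2) * (norm (y - x))\<^sup>2"
      unfolding e_def u_def[symmetric] v_def[symmetric]
      by (simp add: power2_norm_eq_inner inner_diff_left inner_diff_right inner_add_left
          inner_add_right inner_commute add_divide_distrib diff_divide_distrib)
  qed
  then show thesis using that env env' by blast
qed

lemma envelope_gradient_in_Gamma0:
  assumes h: "envelope_gradient h G"
  shows "(\<lambda>x. ereal (h x)) \<in> Gamma0"
proof -
  have "convex_fun (\<lambda>x. ereal (h x))"
    unfolding convex_fun_ereal_iff using convex_on_if_subgradients envelope_gradientD(1)[OF h] by blast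
  moreover have "lower_semicontinuous (\<lambda>x. ereal (h x))"
    unfolding lower_semicontinuous_def le_Liminf_iff
    using continuous_if_envelope_gradient[OF h] by (intro allI impI order_tendstoD(1)) auto
  ultimately show ?thesis by (simp add: Gamma0_def proper_fun_def)
qed

text \<open>The epigraph of a supremum is the intersection of the epigraphs.\<close>

lemma Gamma0_SUP:
  fixes F :: "'i \<Rightarrow> 'a::real_normed_vector \<Rightarrow> ereal"
  assumes F: "\<And>i. F i \<in> Gamma0" and fin: "(SUP i. F i y) \<noteq> \<infinity>"
  shows "(\<lambda>x. SUP i. F i x) \<in> Gamma0"
proof -
  have "epi (\<lambda>x. SUP i. F i x) = (\<Inter>i. epi (F i))"
    by (auto simp: epi_def SUP_le_iff)
  moreover have "convex (epi (F i))" for i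
    using F by (simp add: Gamma0_def convex_fun_def)
  ultimately have "convex_fun (\<lambda>x. SUP i. F i x)"
    by (auto simp: convex_fun_def intro: convex_INT)
  moreover have "lower_semicontinuous (\<lambda>x. SUP i. F i x)"
    unfolding lower_semicontinuous_iff_eventually
  proof (intro allI impI)
    fix x c assume "c < (SUP i. F i x)"
    then obtain i where "c < F i x" by (auto simp: less_SUP_iff)
    then have "\<forall>\<^sub>F y in nhds x. c < F i y"
      using F[of i] unfolding Gamma0_def lower_semicontinuous_iff_eventually by auto
    then show "\<forall>\<^sub>F y in nhds x. c < (SUP i. F i y)"
      by eventually_elim (auto simp: less_SUP_iff)
  qed
  moreover have "(SUP i. F i x) \<noteq> -\<infinity>" for x
  proof -
    fix i0 :: 'i
    have "-\<infinity> < F i0 x" using F[of i0] by (simp add: Gamma0_def proper_fun_def)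
    also have "F i0 x \<le> (SUP i. F i x)" by (rule SUP_upper) simp
    finally show ?thesis by simp
  qed
  ultimately show ?thesis using fin by (auto simp: Gamma0_def proper_fun_def)
qed

text \<open>
  The function \<open>k\<close> with envelope \<open>h\<close> is the deconvolution
  \<open>k y = sup\<^sub>x (h x - \<parallel>x - y\<parallel>\<^sup>2/2)\<close>. The upper bound on \<open>h\<close> makes the supremum at
  \<open>y = x - G x\<close> attained at \<open>x\<close>; the lower bound gives \<open>G x \<in> \<partial>k (x - G x)\<close>, so that
  \<open>x - G x\<close> is the proximal point of \<open>x\<close>.
\<close>

lemma envelope_gradient_imp_env:
  fixes h :: "'a::{real_inner, banach} \<Rightarrow> real"
  assumes h: "envelope_gradient h G"
  obtains k where "k \<in> Gamma0" and "env k = (\<lambda>x. ereal (h x))" and "prox k = (\<lambda>x. x - G x)"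
proof -
  \<comment> \<open>Substituting \<open>x = y + z\<close> exhibits \<open>k\<close> as a supremum of translates of \<open>h\<close>, hence of convex functions.\<close>
  define k where "k = (\<lambda>y. SUP z. ereal (h (y + z) - (1/2) * (norm z)\<^sup>2))"
  have k_value: "k (x - G x) = ereal (h x - (1/2) * (norm (G x))\<^sup>2)" for x
    unfolding k_def
  proof (rule antisym)
    show "(SUP z. ereal (h (x - G x + z) - (1/2) * (norm z)\<^sup>2)) \<le> ereal (h x - (1/2) * (norm (G x))\<^sup>2)"
    proof (rule SUP_least)
      fix z
      have "h (x - G x + z) \<le> h x + (z - G x) \<bullet> G x + (1/2) * (norm (z - G x))\<^sup>2"
        using envelope_gradientD(2)[OF h, of "x - G x + z" x] by simp
      then show "ereal (h (x - G x + z) - (1/2) * (norm z)\<^sup>2) \<le> ereal (h x - (1/2) * (norm (G x))\<^sup>2)"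
        by (simp add: power2_norm_eq_inner inner_diff_left inner_diff_right inner_commute
        add_divide_distrib diff_divide_distrib)
    qed
    show "ereal (h x - (1/2) * (norm (G x))\<^sup>2) \<le> (SUP z. ereal (h (x - G x + z) - (1/2) * (norm z)\<^sup>2))"
      by (rule SUP_upper2[of "G x"]) auto
  qed
  have k: "k \<in> Gamma0"
    unfolding k_def
  proof (rule Gamma0_SUP)
    fix z
    have "envelope_gradient (\<lambda>y. h (y + z) - (1/2) * (norm z)\<^sup>2) (\<lambda>y. G (y + z))"
      unfolding envelope_gradient_def
    proof (intro allI conjI)
      fix x y
      show "h (x + z) - (1/2) * (norm z)\<^sup>2 + (y - x) \<bullet> G (x + z) \<le> h (y + z) - (1/2) * (norm z)\<^sup>2"
        using envelope_gradientD(1)[OF h, of "x + z" "y + z"] by simp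
      show "h (y + z) - (1/2) * (norm z)\<^sup>2
          \<le> h (x + z) - (1/2) * (norm z)\<^sup>2 + (y - x) \<bullet> G (x + z) + (1/2) * (norm (y - x))\<^sup>2"
        using envelope_gradientD(2)[OF h, of "y + z" "x + z"] by simp
    qed
    then show "(\<lambda>y. ereal (h (y + z) - (1/2) * (norm z)\<^sup>2)) \<in> Gamma0"
      by (rule envelope_gradient_in_Gamma0)
    show "(SUP z. ereal (h (0 - G 0 + z) - (1/2) * (norm z)\<^sup>2)) \<noteq> \<infinity>"
      using k_value[of 0] unfolding k_def by simp
  qed
  have sub: "x - (x - G x) \<in> subdifferential k (x - G x)" for x
    unfolding subdifferential_def
  proof (intro CollectI allI)
    fix y
    have "h x + (y + G x - x) \<bullet> G x \<le> h (y + G x)"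
      by (rule envelope_gradientD(1)[OF h])
    then have "k (x - G x) + ereal ((y - (x - G x)) \<bullet> (x - (x - G x)))
        \<le> ereal (h (y + G x) - (1/2) * (norm (G x))\<^sup>2)"
      unfolding k_value by (simp add: algebra_simps)
    also have "\<dots> \<le> k y" unfolding k_def by (rule SUP_upper) simp
    finally show "k (x - G x) + ereal ((y - (x - G x)) \<bullet> (x - (x - G x))) \<le> k y" .
  qed
  have "env k = (\<lambda>x. ereal (h x))"
    using env_eqI[OF k_value sub] by auto
  moreover have "prox k = (\<lambda>x. x - G x)"
    using prox_eqI[OF k sub] by blast
  ultimately show thesis using that k by blast
qed

section \<open>The equivalences\<close>

theorem mainTheorem5:
  fixes f g :: "'a::{real_inner, banach} \<Rightarrow> ereal"
  assumes "f \<in> Gamma0" and "g \<in> Gamma0"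
  shows
    "(env g \<preceq>\<^sub>M env f
        \<longleftrightarrow> convex_fun (\<lambda>x. env f x - env g x))
   \<and> (convex_fun (\<lambda>x. env f x - env g x)
        \<longleftrightarrow> convex_fun (\<lambda>x. env (fenchel_conjugate g) x - env (fenchel_conjugate f) x))
   \<and> (convex_fun (\<lambda>x. env (fenchel_conjugate g) x - env (fenchel_conjugate f) x)
        \<longleftrightarrow> monotone_operator (\<lambda>x. prox g x - prox f x))
   \<and> (monotone_operator (\<lambda>x. prox g x - prox f x)
        \<longleftrightarrow> (\<lambda>x. env f x - env g x) \<in> M0)
   \<and> ((\<lambda>x. env f x - env g x) \<in> M0
        \<longleftrightarrow> (\<lambda>x. prox g x - prox f x) \<in> prox_maps)
   \<and> ((\<lambda>x. prox g x - prox f x) \<in> prox_maps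
        \<longleftrightarrow> prox f \<preceq>\<^sub>R prox g)"
proof -
  obtain ef where ef: "env f = (\<lambda>x. ereal (ef x))"
    "env (fenchel_conjugate f) = (\<lambda>x. ereal ((1/2) * (norm x)\<^sup>2 - ef x))"
    "envelope_gradient ef (\<lambda>x. x - prox f x)"
    using Gamma0_envelope[OF assms(1)] .
  obtain eg where eg: "env g = (\<lambda>x. ereal (eg x))"
    "env (fenchel_conjugate g) = (\<lambda>x. ereal ((1/2) * (norm x)\<^sup>2 - eg x))"
    "envelope_gradient eg (\<lambda>x. x - prox g x)"
    using Gamma0_envelope[OF assms(2)] .
  define h where "h = (\<lambda>x. ef x - eg x)"
  define G where "G = (\<lambda>x. prox g x - prox f x)"
  have diff: "(\<lambda>x. env f x - env g x) = (\<lambda>x. ereal (h x))"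
    by (simp add: ef eg h_def)
  have conj_diff: "(\<lambda>x. env (fenchel_conjugate g) x - env (fenchel_conjugate f) x) = (\<lambda>x. ereal (h x))"
    by (simp add: ef eg h_def)
  have quad: "\<bar>h y - h x - (y - x) \<bullet> G x\<bar> \<le> (1/2) * (norm (y - x))\<^sup>2" for x y
    using envelope_gradientD(1)[OF ef(3), of x y] envelope_gradientD(2)[OF ef(3), of y x]
      envelope_gradientD(1)[OF eg(3), of x y] envelope_gradientD(2)[OF eg(3), of y x]
    unfolding h_def G_def abs_le_iff inner_diff_right by linarith

  let ?E = "envelope_gradient h G"
  have E_iff: "?E \<longleftrightarrow> (\<forall>x y. h x + (y - x) \<bullet> G x \<le> h y)"
  proof -
    have "h y \<le> h x + (y - x) \<bullet> G x + (1/2) * (norm (y - x))\<^sup>2" for x y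
      using quad[of y x] by linarith
    then show ?thesis by (simp add: envelope_gradient_def)
  qed

  have convex: "convex_on UNIV h \<longleftrightarrow> ?E"
  proof
    assume c: "convex_on UNIV h"
    have "h x + (y - x) \<bullet> G x - (1/2) * (norm (y - x))\<^sup>2 \<le> h y" for x y
      using quad[of y x] by linarith
    from subgradient_if_convex_on[OF c this] show ?E by (simp add: E_iff)
  next
    assume ?E
    then show "convex_on UNIV h"
      using convex_on_if_subgradients envelope_gradientD(1) by blast
  qed
  have monotone: "monotone_operator G" if ?E
    unfolding monotone_operator_def
  proof (intro allI)
    fix x y
    show "0 \<le> (x - y) \<bullet> (G x - G y)"
      using envelope_gradientD(1)[OF that, of x y] envelope_gradientD(1)[OF that, of y x]
      by (simp add: inner_diff_left inner_diff_right)
  qed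
  have monotone': ?E if "monotone_operator G"
    using subgradient_if_monotone_gradient[OF that quad] by (simp add: E_iff)

  have a: "env g \<preceq>\<^sub>M env f \<longleftrightarrow> ?E"
  proof
    assume "env g \<preceq>\<^sub>M env f"
    then obtain k where k: "k \<in> Gamma0" "env f = (\<lambda>x. env g x + k x)"
      by (auto simp: moreau_le_def)
    have "k x = ereal (h x)" for x
      using fun_cong[OF k(2), of x] by (cases "k x") (auto simp: ef eg h_def)
    then have "k = (\<lambda>x. ereal (h x))" by blast
    then have "convex_fun (\<lambda>x. ereal (h x))" using k(1) by (simp add: Gamma0_def)
    then show ?E by (simp add: convex_fun_ereal_iff convex)
  next
    assume ?E
    then have "(\<lambda>x. ereal (h x)) \<in> Gamma0" by (rule envelope_gradient_in_Gamma0)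
    moreover have "env f = (\<lambda>x. env g x + ereal (h x))" by (simp add: ef eg h_def)
    ultimately show "env g \<preceq>\<^sub>M env f" by (auto simp: moreau_le_def)
  qed
  have e: "(\<lambda>x. ereal (h x)) \<in> M0 \<longleftrightarrow> ?E"
  proof
    assume "(\<lambda>x. ereal (h x)) \<in> M0"
    then obtain k where k: "k \<in> Gamma0" "env k = (\<lambda>x. ereal (h x))" by (auto simp: M0_def)
    obtain d where d: "env k = (\<lambda>x. ereal (d x))" "envelope_gradient d (\<lambda>x. x - prox k x)"
      using Gamma0_envelope[OF k(1)] by metis
    have "d = h" using d(1) k(2) by (simp add: fun_eq_iff)
    moreover have "convex_on UNIV d"
      by (rule convex_on_if_subgradients, rule envelope_gradientD(1)[OF d(2)])
    ultimately show ?E by (simp add: convex)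
  next
    assume ?E
    then obtain k where "k \<in> Gamma0" "env k = (\<lambda>x. ereal (h x))"
      using envelope_gradient_imp_env by metis
    then show "(\<lambda>x. ereal (h x)) \<in> M0" unfolding M0_def by (metis image_eqI)
  qed
  have f: "G \<in> prox_maps" if E: ?E
  proof -
    obtain k where "k \<in> Gamma0" "prox k = (\<lambda>x. x - (x - G x))"
      using envelope_gradient_imp_env[OF envelope_gradient_half_square_diff[OF E]] by metis
    then show ?thesis by (auto simp: prox_maps_def image_iff)
  qed
  have g: "G \<in> firmly_nonexpansive_maps" if "G \<in> prox_maps"
    using that prox_firmly_nonexpansive by (auto simp: prox_maps_def)
  have d: "monotone_operator G" if "G \<in> firmly_nonexpansive_maps"
    unfolding monotone_operator_def
  proof (intro allI)
    fix x y
    have "0 \<le> (norm (G x - G y))\<^sup>2" by simp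
    also have "\<dots> \<le> (x - y) \<bullet> (G x - G y)"
      using that by (simp add: firmly_nonexpansive_maps_def)
    finally show "0 \<le> (x - y) \<bullet> (G x - G y)" .
  qed
  have le: "prox f \<preceq>\<^sub>R prox g \<longleftrightarrow> G \<in> firmly_nonexpansive_maps"
    by (simp add: resolvent_le_def G_def)
  show ?thesis
    unfolding diff conj_diff G_def[symmetric] le convex_fun_ereal_iff convex a e
    using monotone monotone' f g d by blast
qed

end
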